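(* Let $(\boldsymbol{\varepsilon},\boldsymbol{\mu})$ be a photonic crystal with spectral bands $\omega_m$ and dispersion curves $\gamma_m$. Let $\gamma_n=\omega_n(\mathbb{T})$ be a closed dispersion curve that does not intersect $\gamma_m$ for any $m\ne n$, and assume that $\omega_n$ extends analytically to a neighbourhood of $\mathbb{T}$. Let $D_n^i$ be a Jordan domain partitioned by $\gamma_n$, with boundary the simple closed curve $\gamma_n^i\subset\gamma_n$, and containing no point of any dispersion curve. (i) If $\mathrm{Ind}(D_n^i)=W(\gamma_n;\omega_B)=1$ for $\omega_B\in D_n^i$, then each $\omega\in D_n^i$ is an eigenvalue of the semi-infinite problem over the interval $I_+=(0,\infty)$, as long as $\omega$ is not a branch point of the eigenvalues $\lambda_j(\omega)$ ($j=1,2,3,4$) of the monodromy matrix $\mathcal{M}(\omega)$. The corresponding eigenfunction $\Phi(z)$ decays exponentially as $z\to\infty$. (ii) If $\mathrm{Ind}(D_n^i)=W(\gamma_n;\omega_B)=-1$ for $\omega_B\in D_n^i$, then each $\omega\in D_n^i$ is an eigenvalue of the semi-infinite problem over the interval $I_-=(-\infty,0)$, as long as $\omega$ is not a branch point of the eigenvalues $\lambda_j(\omega)$ ($j=1,2,3,4$) of $\mathcal{M}(\omega)$. The corresponding eigenfunction $\Phi(z)$ decays exponentially as $z\to-\infty$.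
   Context: Medium and monodromy matrix. $\boldsymbol{\varepsilon},\boldsymbol{\mu}:\mathbb{R}\to\mathbb{C}^{2\times2}$ are bounded, piecewise continuous and $1$-periodic. Put $Q=\begin{pmatrix}0&-1\\1&0\end{pmatrix}$, $\mathcal{Q}=\begin{pmatrix}Q&0\\0&Q\end{pmatrix}$, $\mathcal{A}(z)=\mathrm{i}\begin{pmatrix}0&\boldsymbol{\mu}(z)\\-\boldsymbol{\varepsilon}(z)&0\end{pmatrix}$. For $\omega\in\mathbb{C}$ let $\mathcal{T}_\omega(z,z_1)\in\mathbb{C}^{4\times4}$ solve $\frac{d}{dz}\mathcal{T}_\omega(z,z_1)=\omega\mathcal{Q}^{-1}\mathcal{A}(z)\mathcal{T}_\omega(z,z_1)$, $\mathcal{T}_\omega(z_1,z_1)=I$, and $\mathcal{M}(\omega)=\mathcal{T}_\omega(1,0)$, with eigenvalues $\lambda_1(\omega),\dots,\lambda_4(\omega)$ listed with algebraic multiplicity. A point $\omega$ is called a branch point if the four eigenvalues $\lambda_j(\omega)$ are not pairwise distinct. Bands. $\mathbb{T}$ is the unit circle in $\mathbb{C}$. For $k\in[-\pi,\pi]$, the eigenfrequencies at $k$ are those $\omega\in\mathbb{C}$ for which $\Phi'=\omega\mathcal{Q}^{-1}\mathcal{A}(z)\Phi$, $\Phi(z+1)=e^{\mathrm{i}k}\Phi(z)$ has a nonzero solution, equivalently the zeros of $\omega\mapsto\det(\mathcal{M}(\omega)-e^{\mathrm{i}k}I)$. It is assumed that the eigenfrequencies (counted as zeros with multiplicity) are given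 by a countable family of continuous spectral bands $k\mapsto\omega_m(k)$ on $[-\pi,\pi]$; $\gamma_m=\{\omega_m(k):k\in[-\pi,\pi]\}$, $\Gamma=\bigcup_m\gamma_m=\{\omega:|\lambda_j(\omega)|=1\text{ for some }j\}$. If $\omega_n(-\pi)=\omega_n(\pi)$, $\gamma_n$ is called closed and $\omega_n$ is regarded as a function of $\xi=e^{\mathrm{i}k}\in\mathbb{T}$. Domains partitioned by $\gamma_n$. $\mathbb{C}\setminus\gamma_n$ has one unbounded component and finitely many bounded components $D_n^1,\dots,D_n^{i_0}$. Standing assumption: each $D_n^i$ is a Jordan domain bounded by a Jordan curve $\gamma_n^i\subset\gamma_n$, smooth except at finitely many corners, and $\gamma_m^i\neq\gamma_n^i$ as sets for $m\neq n$. Index and winding number. $\mathrm{Ind}(\omega)=\frac12\big(\#\{j:|\lambda_j(\omega)|<1\}-\#\{j:|\lambda_j(\omega)|>1\}\big)$; it is constant on every connected component of $\mathbb{C}\setminus\Gamma$, and $\mathrm{Ind}(\cdot)$ of a component is this constant. $W(\gamma_n;\omega_B)=\frac{1}{2\pi\mathrm{i}}\int_{\xi\in\mathbb{T}}\frac{d\omega_n(\xi)}{\omega_n(\xi)-\omega_B}$, with $\mathbb{T}$ traversed counterclockwise. Semi-infinite problem. Write $\Phi=(\mathbf{E},\mathbf{H})^T$ with $\mathbf{E},\mathbf{H}\in\mathbb{C}^2$. The crystal occupies $I_+$ (resp. $I_-$) and the rest of the line is vacuum, where the field is outgoing; the outgoing vacuum field for $z<0$ is $(\mathbf{c}_1,\mathbf{c}_2)^Te^{-\mathrm{i}\omega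 z}$ with $\mathbf{c}_2=-Q\mathbf{c}_1$, and for $z>0$ it is $(\mathbf{c}_1,\mathbf{c}_2)^Te^{\mathrm{i}\omega z}$ with $\mathbf{c}_2=Q\mathbf{c}_1$ (wave speed normalized to $1$). Hence $\omega\in\mathbb{C}$ is an eigenvalue of the semi-infinite problem over $I_+$ (resp. $I_-$) with eigenfunction $\Phi$ if $\Phi\neq0$, $\Phi\in(L^2(I_\pm))^4$, $\Phi'(z)=\omega\mathcal{Q}^{-1}\mathcal{A}(z)\Phi(z)$ for $z\in I_\pm$, and $\mathbf{H}(0)=-Q\mathbf{E}(0)$ for $I_+$ (resp. $\mathbf{H}(0)=Q\mathbf{E}(0)$ for $I_-$). Exponential decay as $z\to\pm\infty$ means $|\Phi(z)|\le Ce^{-c|z|}$ on $I_\pm$ for some $C,c>0$. *)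

theory Defs
  imports "HOL-Complex_Analysis.Complex_Analysis"
begin

definition piecewise_continuous :: "(real \<Rightarrow> 'a::topological_space) \<Rightarrow> bool" where
  "piecewise_continuous f \<longleftrightarrow>
     (\<forall>a b. finite {z\<in>{a..b}. \<not> isCont f z}) \<and>
     (\<forall>z. (\<exists>l. (f \<longlongrightarrow> l) (at_left z)) \<and> (\<exists>r. (f \<longlongrightarrow> r) (at_right z)))"

definition photonic_crystal ::
    "(real \<Rightarrow> complex^2^2) \<Rightarrow> (real \<Rightarrow> complex^2^2) \<Rightarrow> bool" where
  "photonic_crystal eps mu \<longleftrightarrow>
     bounded (range eps) \<and> bounded (range mu) \<and>
     piecewise_continuous eps \<and> piecewise_continuous mu \<and>
     (\<forall>z. eps (z + 1) = eps z) \<and> (\<forall>z. mu (z + 1) = mu z)"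

text \<open>The four components of a field are indexed by the sum type \<open>2 + 2\<close>, so that
  \<open>Inl\<close> addresses the electric and \<open>Inr\<close> the magnetic block.\<close>

type_synonym idx = "2 + 2"
type_synonym field4 = "complex^idx"
type_synonym mat4 = "complex^idx^idx"

definition E_part :: "field4 \<Rightarrow> complex^2" where
  "E_part v = (\<chi> a. v $ Inl a)"

definition H_part :: "field4 \<Rightarrow> complex^2" where
  "H_part v = (\<chi> a. v $ Inr a)"

definition block_mat ::
    "complex^2^2 \<Rightarrow> complex^2^2 \<Rightarrow> complex^2^2 \<Rightarrow> complex^2^2 \<Rightarrow> mat4" where
  "block_mat A B C D =
     (\<chi> i j. case i of
        Inl a \<Rightarrow> (case j of Inl b \<Rightarrow> A $ a $ b | Inr b \<Rightarrow> B $ a $ b)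
      | Inr a \<Rightarrow> (case j of Inl b \<Rightarrow> C $ a $ b | Inr b \<Rightarrow> D $ a $ b))"

definition cscale :: "complex \<Rightarrow> complex^'n^'m \<Rightarrow> complex^'n^'m" where
  "cscale c A = (\<chi> i j. c * A $ i $ j)"

definition Q2 :: "complex^2^2" where
  "Q2 = vector [vector [0, -1], vector [1, 0]]"

definition Q4 :: mat4 where
  "Q4 = block_mat Q2 0 0 Q2"

definition A_mat :: "(real \<Rightarrow> complex^2^2) \<Rightarrow> (real \<Rightarrow> complex^2^2) \<Rightarrow> real \<Rightarrow> mat4" where
  "A_mat eps mu z = cscale \<i> (block_mat 0 (mu z) (- eps z) 0)"

definition generator ::
    "(real \<Rightarrow> complex^2^2) \<Rightarrow> (real \<Rightarrow> complex^2^2) \<Rightarrow> complex \<Rightarrow> real \<Rightarrow> mat4" where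
  "generator eps mu \<omega> z = cscale \<omega> (matrix_inv Q4 ** A_mat eps mu z)"

text \<open>Solutions are continuous, up to the boundary of the open interval \<open>I\<close>, and
  satisfy the differential equation wherever the coefficients are continuous; for piecewise
  continuous coefficients this excludes only a locally finite set of points.\<close>

definition maxwell_solution ::
    "(real \<Rightarrow> complex^2^2) \<Rightarrow> (real \<Rightarrow> complex^2^2) \<Rightarrow> complex \<Rightarrow> real set \<Rightarrow>
     (real \<Rightarrow> field4) \<Rightarrow> bool" where
  "maxwell_solution eps mu \<omega> I \<Phi> \<longleftrightarrow>
     continuous_on (closure I) \<Phi> \<and>
     (\<forall>z\<in>I. isCont eps z \<and> isCont mu z \<longrightarrow>
        (\<Phi> has_vector_derivative (generator eps mu \<omega> z *v \<Phi> z)) (at z))"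

definition transfer_matrix ::
    "(real \<Rightarrow> complex^2^2) \<Rightarrow> (real \<Rightarrow> complex^2^2) \<Rightarrow>
     (complex \<Rightarrow> real \<Rightarrow> real \<Rightarrow> mat4) \<Rightarrow> bool" where
  "transfer_matrix eps mu T \<longleftrightarrow>
     (\<forall>\<omega> z1. T \<omega> z1 z1 = mat 1 \<and>
        continuous_on UNIV (\<lambda>z. T \<omega> z z1) \<and>
        (\<forall>z. isCont eps z \<and> isCont mu z \<longrightarrow>
           ((\<lambda>s. T \<omega> s z1) has_vector_derivative (generator eps mu \<omega> z ** T \<omega> z z1)) (at z)))"

definition monodromy :: "(complex \<Rightarrow> real \<Rightarrow> real \<Rightarrow> mat4) \<Rightarrow> complex \<Rightarrow> mat4" where
  "monodromy T \<omega> = T \<omega> 1 0"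

text \<open>\<open>lam \<omega>\<close> lists the eigenvalues of \<open>M \<omega>\<close> with algebraic multiplicity: it factors the
  characteristic polynomial.\<close>

definition eigenvalue_listing ::
    "(complex \<Rightarrow> mat4) \<Rightarrow> (complex \<Rightarrow> 4 \<Rightarrow> complex) \<Rightarrow> bool" where
  "eigenvalue_listing M lam \<longleftrightarrow>
     (\<forall>\<omega> x. det (mat x - M \<omega>) = (\<Prod>j\<in>UNIV. x - lam \<omega> j))"

definition branch_point :: "(complex \<Rightarrow> 4 \<Rightarrow> complex) \<Rightarrow> complex \<Rightarrow> bool" where
  "branch_point lam \<omega> \<longleftrightarrow> \<not> inj (lam \<omega>)"

definition eigenfrequency ::
    "(real \<Rightarrow> complex^2^2) \<Rightarrow> (real \<Rightarrow> complex^2^2) \<Rightarrow> real \<Rightarrow> complex \<Rightarrow> bool" where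
  "eigenfrequency eps mu k \<omega> \<longleftrightarrow>
     (\<exists>\<Phi>. maxwell_solution eps mu \<omega> UNIV \<Phi> \<and>
          (\<forall>z. \<Phi> (z + 1) = exp (\<i> * of_real k) *s \<Phi> z) \<and>
          (\<exists>z. \<Phi> z \<noteq> 0))"

text \<open>The bands are the functions \<open>om m\<close> with \<open>m\<close> in the (finite or infinite) index set \<open>J\<close>.
  At every \<open>k\<close> an eigenfrequency occurs among the \<open>om m k\<close> as often as its multiplicity as a
  zero of the dispersion function.\<close>

definition spectral_bands ::
    "(real \<Rightarrow> complex^2^2) \<Rightarrow> (real \<Rightarrow> complex^2^2) \<Rightarrow> (complex \<Rightarrow> mat4) \<Rightarrow>
     nat set \<Rightarrow> (nat \<Rightarrow> real \<Rightarrow> complex) \<Rightarrow> bool" where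
  "spectral_bands eps mu M J om \<longleftrightarrow>
     (\<forall>m\<in>J. continuous_on {-pi..pi} (om m)) \<and>
     (\<forall>k\<in>{-pi..pi}.
        {\<omega>. eigenfrequency eps mu k \<omega>} = (\<lambda>m. om m k) ` J \<and>
        (\<forall>\<omega>. eigenfrequency eps mu k \<omega> \<longrightarrow>
           finite {m\<in>J. om m k = \<omega>} \<and>
           zorder (\<lambda>w. det (M w - mat (exp (\<i> * of_real k)))) \<omega> =
             int (card {m\<in>J. om m k = \<omega>})))"

definition band_curve :: "(nat \<Rightarrow> real \<Rightarrow> complex) \<Rightarrow> nat \<Rightarrow> complex set" where
  "band_curve om m = om m ` {-pi..pi}"

definition closed_band :: "(nat \<Rightarrow> real \<Rightarrow> complex) \<Rightarrow> nat \<Rightarrow> bool" where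
  "closed_band om n \<longleftrightarrow> om n (-pi) = om n pi"

text \<open>\<open>F \<xi>\<close> with \<open>\<xi> = exp (\<i> k)\<close> is the band as a function on the unit circle; \<open>analytic_on\<close>
  means holomorphic on an open neighbourhood of the set.\<close>

definition extends_analytically :: "(nat \<Rightarrow> real \<Rightarrow> complex) \<Rightarrow> nat \<Rightarrow> bool" where
  "extends_analytically om n \<longleftrightarrow>
     (\<exists>F. F analytic_on sphere 0 1 \<and>
          (\<forall>k\<in>{-pi..pi}. F (exp (\<i> * of_real k)) = om n k))"

definition partitioned_domains :: "complex set \<Rightarrow> complex set set" where
  "partitioned_domains g = {D \<in> components (- g). bounded D}"

text \<open>Smooth except at finitely many corners: continuously differentiable with nonvanishing
  derivative on each closed arc between consecutive points of a finite subdivision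
  (one-sided derivatives at the ends of the arcs).\<close>

definition piecewise_smooth :: "(real \<Rightarrow> complex) \<Rightarrow> bool" where
  "piecewise_smooth c \<longleftrightarrow>
     (\<exists>S. finite S \<and> {0, 1} \<subseteq> S \<and> S \<subseteq> {0..1} \<and>
        (\<forall>a\<in>S. \<forall>b\<in>S. a < b \<and> {a<..<b} \<inter> S = {} \<longrightarrow>
           (\<exists>c'. continuous_on {a..b} c' \<and>
              (\<forall>t\<in>{a..b}. c' t \<noteq> 0 \<and>
                 (c has_vector_derivative c' t) (at t within {a..b})))))"

definition smooth_jordan_curve :: "complex set \<Rightarrow> bool" where
  "smooth_jordan_curve g \<longleftrightarrow>
     (\<exists>c. simple_path c \<and> pathfinish c = pathstart c \<and> piecewise_smooth c \<and> path_image c = g)"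

definition jordan_domain_bounded_by :: "complex set \<Rightarrow> complex set \<Rightarrow> bool" where
  "jordan_domain_bounded_by D g \<longleftrightarrow> smooth_jordan_curve g \<and> D = inside g \<and> frontier D = g"

definition partition_assumption :: "nat set \<Rightarrow> (nat \<Rightarrow> real \<Rightarrow> complex) \<Rightarrow> bool" where
  "partition_assumption J om \<longleftrightarrow>
     (\<forall>m\<in>J. finite (partitioned_domains (band_curve om m)) \<and>
        (\<forall>D\<in>partitioned_domains (band_curve om m).
           \<exists>g. g \<subseteq> band_curve om m \<and> jordan_domain_bounded_by D g)) \<and>
     (\<forall>m\<in>J. \<forall>n\<in>J. m \<noteq> n \<longrightarrow>
        (\<forall>D\<in>partitioned_domains (band_curve om m).
           \<forall>D'\<in>partitioned_domains (band_curve om n). frontier D \<noteq> frontier D'))"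

definition Ind :: "(complex \<Rightarrow> 4 \<Rightarrow> complex) \<Rightarrow> complex \<Rightarrow> real" where
  "Ind lam \<omega> =
     (real (card {j. cmod (lam \<omega> j) < 1}) - real (card {j. cmod (lam \<omega> j) > 1})) / 2"

definition has_Ind :: "(complex \<Rightarrow> 4 \<Rightarrow> complex) \<Rightarrow> complex set \<Rightarrow> real \<Rightarrow> bool" where
  "has_Ind lam D c \<longleftrightarrow> D \<noteq> {} \<and> (\<forall>\<omega>\<in>D. Ind lam \<omega> = c)"

text \<open>The loop is \<open>\<xi> \<mapsto> \<omega>\<^sub>n(\<xi>)\<close> on the unit circle traversed once counterclockwise from
  \<open>exp (-\<i> \<pi>)\<close>, so \<open>contour_integral\<close> along it is the integral of \<open>d\<omega>\<^sub>n(\<xi>) / (\<omega>\<^sub>n(\<xi>) - \<omega>\<^sub>B)\<close>.\<close>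

definition band_loop :: "(nat \<Rightarrow> real \<Rightarrow> complex) \<Rightarrow> nat \<Rightarrow> real \<Rightarrow> complex" where
  "band_loop om n t = om n (-pi + 2 * pi * t)"

definition W :: "(nat \<Rightarrow> real \<Rightarrow> complex) \<Rightarrow> nat \<Rightarrow> complex \<Rightarrow> complex" where
  "W om n wB = 1 / (2 * of_real pi * \<i>) * contour_integral (band_loop om n) (\<lambda>w. 1 / (w - wB))"

definition eigenfunction_plus ::
    "(real \<Rightarrow> complex^2^2) \<Rightarrow> (real \<Rightarrow> complex^2^2) \<Rightarrow> complex \<Rightarrow> (real \<Rightarrow> field4) \<Rightarrow> bool" where
  "eigenfunction_plus eps mu \<omega> \<Phi> \<longleftrightarrow>
     maxwell_solution eps mu \<omega> {0<..} \<Phi> \<and>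
     (\<exists>z\<in>{0<..}. \<Phi> z \<noteq> 0) \<and>
     set_integrable lborel {0<..} (\<lambda>z. (norm (\<Phi> z))\<^sup>2) \<and>
     H_part (\<Phi> 0) = - (Q2 *v E_part (\<Phi> 0))"

definition eigenfunction_minus ::
    "(real \<Rightarrow> complex^2^2) \<Rightarrow> (real \<Rightarrow> complex^2^2) \<Rightarrow> complex \<Rightarrow> (real \<Rightarrow> field4) \<Rightarrow> bool" where
  "eigenfunction_minus eps mu \<omega> \<Phi> \<longleftrightarrow>
     maxwell_solution eps mu \<omega> {..<0} \<Phi> \<and>
     (\<exists>z\<in>{..<0}. \<Phi> z \<noteq> 0) \<and>
     set_integrable lborel {..<0} (\<lambda>z. (norm (\<Phi> z))\<^sup>2) \<and>
     H_part (\<Phi> 0) = Q2 *v E_part (\<Phi> 0)"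

definition eigenvalue_plus ::
    "(real \<Rightarrow> complex^2^2) \<Rightarrow> (real \<Rightarrow> complex^2^2) \<Rightarrow> complex \<Rightarrow> bool" where
  "eigenvalue_plus eps mu \<omega> \<longleftrightarrow> (\<exists>\<Phi>. eigenfunction_plus eps mu \<omega> \<Phi>)"

definition eigenvalue_minus ::
    "(real \<Rightarrow> complex^2^2) \<Rightarrow> (real \<Rightarrow> complex^2^2) \<Rightarrow> complex \<Rightarrow> bool" where
  "eigenvalue_minus eps mu \<omega> \<longleftrightarrow> (\<exists>\<Phi>. eigenfunction_minus eps mu \<omega> \<Phi>)"

definition decays_exponentially_on :: "real set \<Rightarrow> (real \<Rightarrow> field4) \<Rightarrow> bool" where
  "decays_exponentially_on I \<Phi> \<longleftrightarrow>
     (\<exists>C>0. \<exists>c>0. \<forall>z\<in>I. norm (\<Phi> z) \<le> C * exp (- c * \<bar>z\<bar>))"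

end

theory Submission
  imports Defs
begin

text \<open>
  No point of \<open>D\<close> lies on a dispersion curve, so no eigenvalue of the monodromy matrix has modulus
  one there; index \<open>1\<close> then means that three eigenvalues lie inside the unit circle and one outside.
  Away from branch points the four Bloch modes form a basis of the solution space. The three
  decaying ones span a three-dimensional space of initial values in \<open>\<complex>\<^sup>4\<close>, which must meet the
  two-dimensional space cut out by the radiation condition. Conversely, a square integrable
  solution is bounded at the integers by Gronwall's inequality, so it has no growing component
  and decays exponentially. Index \<open>-1\<close> reduces to this case by the reflection \<open>z \<mapsto> -z\<close>, which
  inverts the eigenvalues.
\<close>

section \<open>Matrices over the complex numbers\<close>

text \<open>The Euclidean norm is at most the sum of the moduli of the components. The constant is
  crude, but only its independence of the vector matters.\<close>

lemma norm_matrix_vector_mult_le: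
  fixes A :: "complex^'n^'m"
  shows "norm (A *v x) \<le> (\<Sum>i\<in>UNIV. \<Sum>j\<in>UNIV. norm (A $ i $ j)) * norm x"
proof -
  have "norm (A *v x) \<le> (\<Sum>i\<in>UNIV. norm ((A *v x) $ i))"
    unfolding norm_vec_def by (rule L2_set_le_sum) simp
  also have "\<dots> \<le> (\<Sum>i\<in>UNIV. \<Sum>j\<in>UNIV. norm (A $ i $ j) * norm x)"
  proof (rule sum_mono)
    fix i
    have "norm ((A *v x) $ i) \<le> (\<Sum>j\<in>UNIV. norm (A $ i $ j * x $ j))"
      unfolding matrix_vector_mult_def by (simp add: norm_sum)
    also have "\<dots> \<le> (\<Sum>j\<in>UNIV. norm (A $ i $ j) * norm x)"
      by (intro sum_mono) (simp add: norm_mult mult_left_mono Finite_Cartesian_Product.norm_nth_le)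
    finally show "norm ((A *v x) $ i) \<le> (\<Sum>j\<in>UNIV. norm (A $ i $ j) * norm x)" .
  qed
  finally show ?thesis by (simp add: sum_distrib_right)
qed

text \<open>Lets continuity and derivatives pass from the transfer matrix to the solutions it
  generates.\<close>

lemma bounded_linear_matrix_vector_mult_left:
  "bounded_linear (\<lambda>A :: complex^'n^'m. A *v v)"
  by (intro linear_conv_bounded_linear[THEN iffD1] linearI)
    (simp_all add: vec_eq_iff matrix_vector_mult_def distrib_right sum.distrib scaleR_sum_right)

section \<open>Eigenvectors and diagonalization\<close>

lemma det_0_imp_ex_kernel:
  fixes A :: "'a::field^'n^'n"
  assumes "det A = 0"
  obtains v where "v \<noteq> 0" "A *v v = 0"
  using assms invertible_det_nz[of A] invertible_left_inverse[of A] matrix_left_invertible_ker[of A]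
  by auto

lemma mat_mult_vec: "mat c *v v = c *s (v :: 'a::comm_semiring_1^'n)"
proof -
  have "(\<Sum>j\<in>UNIV. (if i = j then c else 0) * v $ j) = c * v $ i" for i
    by (subst sum.remove[of _ i]) (auto intro!: sum.neutral)
  then show ?thesis
    by (simp add: vec_eq_iff matrix_vector_mult_def mat_def)
qed

text \<open>Applying \<open>M\<close> minus \<open>l a\<close> to the relation removes the term of
  \<open>a\<close> and multiplies the others by the nonzero factors \<open>l j - l a\<close>. The
  \<open>y j\<close> may vanish, so scalar coefficients can be absorbed in them.\<close>

lemma eigenvectors_sum_zero:
  fixes M :: "'a::field^'n^'n"
  assumes "finite S" "inj_on l S" "\<forall>j\<in>S. M *v y j = l j *s y j" "(\<Sum>j\<in>S. y j) = 0"
  shows "\<forall>j\<in>S. y j = 0"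
  using assms
proof (induction S arbitrary: y rule: finite_induct)
  case (insert a S)
  let ?y = "\<lambda>j. (l j - l a) *s y j"
  have "(\<Sum>j\<in>insert a S. ?y j) = (\<Sum>j\<in>insert a S. M *v y j - l a *s y j)"
    using insert.prems(2) by (intro sum.cong) (auto simp: vec.scale_left_diff_distrib)
  also have "\<dots> = M *v (\<Sum>j\<in>insert a S. y j) - l a *s (\<Sum>j\<in>insert a S. y j)"
    unfolding sum_subtractf vec.sum vec.scale_sum_right ..
  also have "\<dots> = 0"
    unfolding insert.prems(3) by simp
  finally have "(\<Sum>j\<in>S. ?y j) = 0"
    using insert.hyps by simp
  moreover have "\<forall>j\<in>S. M *v ?y j = l j *s ?y j"
    using insert.prems(2) by (simp only: vector_scalar_commute vec.scale_scale mult.commute) auto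
  ultimately have "\<forall>j\<in>S. ?y j = 0"
    using insert.prems(1) by (intro insert.IH) auto
  then have *: "\<forall>j\<in>S. y j = 0"
    using insert.hyps(2) inj_onD[OF insert.prems(1), of _ a] by fastforce
  then have "y a = 0"
    using insert.hyps insert.prems(3) by simp
  with * show ?case by simp
qed simp

text \<open>The columns of \<open>P\<close> are eigenvectors, independent because the eigenvalues
  are distinct. The conclusion is \<open>M P = P diag(l)\<close> read on vectors, with
  \<open>x\<close> the coefficients of \<open>P *v x\<close> in the eigenbasis.\<close>

lemma ex_eigenbasis:
  fixes M :: "'a::field^'n^'n" and l :: "'n \<Rightarrow> 'a"
  assumes "inj l" "\<And>j. det (mat (l j) - M) = 0"
  obtains P where "invertible P" "\<And>x. M *v (P *v x) = P *v (\<chi> j. l j * x $ j)"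
proof -
  have "\<exists>v. v \<noteq> 0 \<and> M *v v = l j *s v" for j
    using det_0_imp_ex_kernel[OF assms(2)[of j]]
    by (metis mat_mult_vec matrix_vector_mult_diff_rdistrib eq_iff_diff_eq_0)
  then obtain v where v: "\<And>j. v j \<noteq> 0" "\<And>j. M *v v j = l j *s v j"
    by metis
  define P where "P = (\<chi> i j. v j $ i)"
  have P: "P *v x = (\<Sum>j\<in>UNIV. x $ j *s v j)" for x
    by (simp add: P_def vec_eq_iff matrix_vector_mult_def mult.commute)
  show thesis
  proof
    have "x = 0" if "P *v x = 0" for x
    proof -
      have "\<forall>j\<in>UNIV. x $ j *s v j = 0"
        using assms(1) that
        by (intro eigenvectors_sum_zero[where l = l and M = M])
           (auto simp: P vector_scalar_commute v mult.commute)
      then show ?thesis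
        using v(1) by (simp only: vec.scale_eq_0_iff vec_eq_iff[of x] zero_index) blast
    qed
    then show "invertible P"
      by (simp add: invertible_left_inverse matrix_left_invertible_ker)
    show "M *v (P *v x) = P *v (\<chi> j. l j * x $ j)" for x
      by (simp add: P vec.sum vector_scalar_commute v mult.commute)
  qed
qed

section \<open>Linear systems with periodic coefficients\<close>

text \<open>The product of \<open>exp (- 2 * K * z)\<close> and the squared norm of \<open>u\<close>
  is nonincreasing. The square is differentiable also where \<open>u\<close> vanishes, and the
  fundamental theorem of calculus tolerates the finite set \<open>S\<close>.\<close>

lemma gronwall_piecewise:
  fixes u :: "real \<Rightarrow> 'a::real_inner"
  assumes "a \<le> b" "finite S" "continuous_on {a..b} u"
    and deriv: "\<And>z. z \<in> {a<..<b} - S \<Longrightarrow> (u has_vector_derivative u' z) (at z)"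
    and le: "\<And>z. z \<in> {a<..<b} - S \<Longrightarrow> norm (u' z) \<le> K * norm (u z)"
  shows "norm (u b) \<le> exp (K * (b - a)) * norm (u a)"
proof -
  define f where "f = (\<lambda>z. exp (- 2 * K * z) * (u z \<bullet> u z))"
  \<comment> \<open>The value 0 at the end points and on \<open>S\<close> makes the sign of
    \<open>f'\<close> hold everywhere; finitely many values do not affect the integral.\<close>
  define f' where "f' = (\<lambda>z. if z \<in> {a<..<b} - S
     then exp (- 2 * K * z) * (2 * (u z \<bullet> u' z) - 2 * K * (u z \<bullet> u z)) else 0)"
  have "(f' has_integral (f b - f a)) {a..b}"
  proof (rule fundamental_theorem_of_calculus_interior_strong[OF assms(2,1)])
    show "continuous_on {a..b} f"
      unfolding f_def by (intro continuous_intros assms)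
    show "(f has_vector_derivative f' z) (at z)" if "z \<in> {a<..<b} - S" for z
    proof -
      have 1: "((\<lambda>z. u z \<bullet> u z) has_vector_derivative (u z \<bullet> u' z + u' z \<bullet> u z)) (at z)"
        by (rule bounded_bilinear.has_vector_derivative[OF bounded_bilinear_inner deriv[OF that] deriv[OF that]])
      have 2: "((\<lambda>z. exp (- 2 * K * z)) has_vector_derivative (- 2 * K * exp (- 2 * K * z))) (at z)"
        unfolding has_real_derivative_iff_has_vector_derivative[symmetric]
        by (auto intro!: derivative_eq_intros)
      show ?thesis
        using bounded_bilinear.has_vector_derivative[OF bounded_bilinear_mult 2 1] that
        by (simp add: f_def f'_def algebra_simps inner_commute)
    qed
  qed
  moreover have "f' z \<le> 0" for z
  proof (cases "z \<in> {a<..<b} - S")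
    case True
    have "u z \<bullet> u' z \<le> norm (u z) * norm (u' z)"
      by (rule norm_cauchy_schwarz)
    also have "\<dots> \<le> norm (u z) * (K * norm (u z))"
      by (intro mult_left_mono le[OF True]) simp
    also have "\<dots> = K * (u z \<bullet> u z)"
      by (simp add: power2_norm_eq_inner[symmetric] power2_eq_square)
    finally show ?thesis
      using True by (simp add: f'_def mult_le_0_iff)
  next
    case False
    then show ?thesis
      unfolding f'_def by (subst if_not_P) auto
  qed
  ultimately have "f b - f a \<le> 0"
    using has_integral_le[of f' "f b - f a" "{a..b}" "\<lambda>_. 0" 0] by auto
  then have "exp (- 2 * K * b) * (norm (u b))\<^sup>2 \<le> exp (- 2 * K * a) * (norm (u a))\<^sup>2"
    by (simp add: f_def power2_norm_eq_inner)
  then have "exp (2 * K * b) * (exp (- 2 * K * b) * (norm (u b))\<^sup>2)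
      \<le> exp (2 * K * b) * (exp (- 2 * K * a) * (norm (u a))\<^sup>2)"
    by (rule mult_left_mono) simp
  then have "(norm (u b))\<^sup>2 \<le> exp (2 * K * (b - a)) * (norm (u a))\<^sup>2"
    by (simp only: mult.assoc[symmetric] exp_add[symmetric]) (simp add: right_diff_distrib)
  also have "\<dots> = (exp (K * (b - a)) * norm (u a))\<^sup>2"
    by (simp add: power_mult_distrib exp_double[symmetric] mult.assoc)
  finally show ?thesis
    by (rule power2_le_imp_le) simp
qed

text \<open>No derivative is asked for on \<open>X\<close>, the set of possible jumps; continuity on
  the closure of \<open>I\<close> joins the pieces and supplies boundary values. Abstracting from
  Maxwell's equations makes the reflected system an instance as well.\<close>

definition ode_solution ::
    "(real \<Rightarrow> complex^'n^'n) \<Rightarrow> real set \<Rightarrow> real set \<Rightarrow> (real \<Rightarrow> complex^'n) \<Rightarrow> bool" where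
  "ode_solution G X I \<Phi> \<longleftrightarrow>
     continuous_on (closure I) \<Phi> \<and>
     (\<forall>z\<in>I. z \<notin> X \<longrightarrow> (\<Phi> has_vector_derivative (G z *v \<Phi> z)) (at z))"

lemma ode_solution_subset: "ode_solution G X I \<Phi> \<Longrightarrow> I' \<subseteq> I \<Longrightarrow> ode_solution G X I' \<Phi>"
  unfolding ode_solution_def by (meson closure_mono continuous_on_subset subsetD)

lemma ode_solution_diff:
  assumes "ode_solution G X I \<Phi>" "ode_solution G X I \<Psi>"
  shows "ode_solution G X I (\<lambda>z. \<Phi> z - \<Psi> z)"
  using assms unfolding ode_solution_def
  by (auto intro!: continuous_on_diff has_vector_derivative_diff simp: matrix_vector_mult_diff_distrib)

section \<open>Reflection and translation of solutions\<close>

lemma has_vector_derivative_reflect: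
  assumes "(f has_vector_derivative d) (at (- z))"
  shows "((\<lambda>s. f (- s)) has_vector_derivative (- d)) (at z)"
proof -
  have "(uminus has_vector_derivative -1) (at z)"
    by (auto intro!: derivative_eq_intros)
  from vector_diff_chain_at[OF this assms] show ?thesis
    by (simp add: o_def)
qed

lemma has_vector_derivative_shift:
  assumes "(f has_vector_derivative d) (at (z + c))"
  shows "((\<lambda>s. f (s + c)) has_vector_derivative d) (at (z :: real))"
proof -
  have "((\<lambda>s. s + c) has_vector_derivative 1) (at z)"
    by (auto intro!: derivative_eq_intros)
  from vector_diff_chain_at[OF this assms] show ?thesis
    by (simp add: o_def)
qed

text \<open>The chain rule changes the sign of the coefficient matrix. This turns the left half-line
  into the right one, and forward estimates into backward ones.\<close>

lemma ode_solution_reflect: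
  assumes "ode_solution G X I \<Phi>"
  shows "ode_solution (\<lambda>z. - G (- z)) {z. - z \<in> X} (uminus ` I) (\<lambda>z. \<Phi> (- z))"
  unfolding ode_solution_def
proof (intro conjI ballI impI)
  have "closure (uminus ` I) = uminus ` closure I"
    using closure_scaleR[of "-1" I] by simp
  then show "continuous_on (closure (uminus ` I)) (\<lambda>z. \<Phi> (- z))"
    using assms unfolding ode_solution_def
    by (intro continuous_on_compose2[of "closure I" \<Phi> _ uminus] continuous_intros) auto
  fix z assume "z \<in> uminus ` I" "z \<notin> {z. - z \<in> X}"
  then have "(\<Phi> has_vector_derivative (G (- z) *v \<Phi> (- z))) (at (- z))"
    using assms unfolding ode_solution_def by auto
  moreover have "(- G (- z)) *v \<Phi> (- z) = - (G (- z) *v \<Phi> (- z))"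
    by (simp add: matrix_vector_mult_def vec_eq_iff sum_negf)
  ultimately show "((\<lambda>z. \<Phi> (- z)) has_vector_derivative ((- G (- z)) *v \<Phi> (- z))) (at z)"
    by (simp add: has_vector_derivative_reflect)
qed

text \<open>The square is dominated by \<open>C\<^sup>2 * exp (- (2 * c) * z)\<close>, and
  continuity gives measurability.\<close>

lemma exponential_decay_imp_square_integrable:
  fixes \<Phi> :: "real \<Rightarrow> 'a::real_normed_vector"
  assumes cont: "continuous_on {0..} \<Phi>"
    and decay: "\<exists>C>0. \<exists>c>0. \<forall>z\<in>{0<..}. norm (\<Phi> z) \<le> C * exp (- c * \<bar>z\<bar>)"
  shows "set_integrable lborel {0<..} (\<lambda>z. (norm (\<Phi> z))\<^sup>2)"
proof -
  from decay obtain C c where C: "C > 0" "c > 0"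
    and le: "\<And>z. z > 0 \<Longrightarrow> norm (\<Phi> z) \<le> C * exp (- c * \<bar>z\<bar>)"
    by auto
  have "(\<lambda>z. exp (- (2 * c) * z)) absolutely_integrable_on {0..}"
    using C by (intro nonnegative_absolutely_integrable_1 integrable_on_exp_minus_to_infinity) auto
  \<comment> \<open>Absolute integrability refers to the completed Lebesgue measure; Borel
    measurability of the integrand allows the passage to \<open>lborel\<close>.\<close>
  then have "set_integrable lborel {0..} (\<lambda>z. exp (- (2 * c) * z))"
    unfolding set_integrable_def
    by (subst (asm) integrable_completion)
       (auto intro!: borel_measurable_continuous_on_indicator continuous_intros)
  then have "set_integrable lborel {0<..} (\<lambda>z. exp (- (2 * c) * z))"
    by (rule set_integrable_subset) auto
  then have "set_integrable lborel {0<..} (\<lambda>z. C\<^sup>2 * exp (- (2 * c) * z))"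
    by (rule set_integrable_mult_right)
  then show ?thesis
  proof (rule set_integrable_bound)
    show "set_borel_measurable lborel {0<..} (\<lambda>z. (norm (\<Phi> z))\<^sup>2)"
      unfolding set_borel_measurable_def measurable_lborel2
      by (intro borel_measurable_continuous_on_indicator continuous_intros continuous_on_subset[OF cont]) auto
    show "AE z in lborel. z \<in> {0<..} \<longrightarrow> norm ((norm (\<Phi> z))\<^sup>2) \<le> norm (C\<^sup>2 * exp (- (2 * c) * z))"
    proof (intro AE_I2 impI)
      fix z :: real assume "z \<in> {0<..}"
      then have "(norm (\<Phi> z))\<^sup>2 \<le> (C * exp (- c * z))\<^sup>2"
        using le[of z] by (intro power_mono) auto
      also have "\<dots> = C\<^sup>2 * exp (- (2 * c) * z)"
        by (simp add: power_mult_distrib exp_double[symmetric] mult.assoc)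
      finally show "norm ((norm (\<Phi> z))\<^sup>2) \<le> norm (C\<^sup>2 * exp (- (2 * c) * z))"
        by simp
    qed
  qed
qed

text \<open>\<open>X\<close> collects the points where the coefficients may jump; \<open>Y\<close> is the transfer matrix from \<open>0\<close>,
  so \<open>Y 1\<close> is the monodromy matrix.\<close>

locale periodic_system =
  fixes G :: "real \<Rightarrow> complex^'n^'n" and X :: "real set" and K :: real
    and Y :: "real \<Rightarrow> complex^'n^'n"
  assumes finite_X: "finite (X \<inter> {a..b})"
    and G_bound: "norm (G z *v v) \<le> K * norm v"
    and G_periodic: "G (z + 1) = G z"
    and X_periodic: "z + 1 \<in> X \<longleftrightarrow> z \<in> X"
    and Y_0: "Y 0 = mat 1"
    and continuous_Y: "continuous_on UNIV Y"
    and deriv_Y: "z \<notin> X \<Longrightarrow> (Y has_vector_derivative (G z ** Y z)) (at z)"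
begin

section \<open>Two-sided growth bounds\<close>

lemma K_nonneg: "K \<ge> 0"
proof -
  have "0 \<le> K * norm (axis i 1 :: complex^'n)" for i
    by (rule order_trans[OF norm_ge_zero G_bound])
  then show ?thesis
    by (simp add: zero_le_mult_iff not_le axis_eq_0_iff)
qed

lemma solution_growth_bound:
  assumes "ode_solution G X {a<..<b} \<Phi>" "a \<le> b"
  shows "norm (\<Phi> b) \<le> exp (K * (b - a)) * norm (\<Phi> a)"
\<comment> \<open>The closure of \<open>{a<..<b}\<close> is \<open>{a..b}\<close> only for
  \<open>a < b\<close>; for \<open>a = b\<close> the claim is trivial.\<close>
proof (cases "a = b")
  case False
  with assms show ?thesis
    unfolding ode_solution_def
    by (intro gronwall_piecewise[where S = "X \<inter> {a..b}" and u' = "\<lambda>z. G z *v \<Phi> z"] finite_X G_bound) auto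
qed simp

text \<open>The sign change of the coefficients leaves the bound \<open>K\<close> valid, and the
  period is kept. The monodromy matrix becomes \<open>Y (- 1)\<close>.\<close>

lemma reflected: "periodic_system (\<lambda>z. - G (- z)) {z. - z \<in> X} K (\<lambda>z. Y (- z))"
proof
  show "finite ({z. - z \<in> X} \<inter> {a..b})" for a b
    by (rule finite_imageD[of uminus], rule finite_subset[OF _ finite_X[of "-b" "-a"]])
       (auto simp: inj_on_def)
  show "norm (- G (- z) *v v) \<le> K * norm v" for z v
  proof -
    have "- G (- z) *v v = - (G (- z) *v v)"
      by (simp add: matrix_vector_mult_def vec_eq_iff sum_negf)
    then show ?thesis using G_bound by simp
  qed
  show "- G (- (z + 1)) = - G (- z)" for z
    using G_periodic[of "- z - 1"] by simp
  show "z + 1 \<in> {z. - z \<in> X} \<longleftrightarrow> z \<in> {z. - z \<in> X}" for z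
    using X_periodic[of "- z - 1"] by simp
  show "Y (- 0) = mat 1"
    by (simp add: Y_0)
  show "continuous_on UNIV (\<lambda>z. Y (- z))"
    by (intro continuous_on_compose2[OF continuous_Y] continuous_intros) auto
  show "((\<lambda>z. Y (- z)) has_vector_derivative - G (- z) ** Y (- z)) (at z)"
    if "z \<notin> {z. - z \<in> X}" for z
  proof -
    have "- G (- z) ** Y (- z) = - (G (- z) ** Y (- z))"
      by (simp add: matrix_matrix_mult_def vec_eq_iff sum_negf)
    then show ?thesis
      using that by (auto intro!: has_vector_derivative_reflect deriv_Y)
  qed
qed

lemma solution_growth_bound_backward:
  assumes "ode_solution G X {a<..<b} \<Phi>" "a \<le> b"
  shows "norm (\<Phi> a) \<le> exp (K * (b - a)) * norm (\<Phi> b)"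
proof -
  have "uminus ` {a<..<b} = {- b<..<- a}"
    by simp
  then show ?thesis
    using periodic_system.solution_growth_bound[OF reflected, of "- b" "- a" "\<lambda>z. \<Phi> (- z)"]
      ode_solution_reflect[OF assms(1)] assms(2)
    by (simp add: algebra_simps)
qed

section \<open>Uniqueness of solutions and the Floquet relation\<close>

lemma ode_solution_Y: "ode_solution G X I (\<lambda>z. Y z *v v)"
  unfolding ode_solution_def
proof (intro conjI ballI impI)
  show "continuous_on (closure I) (\<lambda>z. Y z *v v)"
    using bounded_linear.continuous_on[OF bounded_linear_matrix_vector_mult_left continuous_Y]
    by (rule continuous_on_subset) simp
  show "((\<lambda>z. Y z *v v) has_vector_derivative G z *v (Y z *v v)) (at z)" if "z \<notin> X" for z
    using bounded_linear.has_vector_derivative[OF bounded_linear_matrix_vector_mult_left deriv_Y[OF that]]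
    by (simp add: matrix_vector_mul_assoc)
qed

text \<open>The difference of the two sides is a solution that vanishes at 0, so the growth bound
  makes it vanish at \<open>z\<close>.\<close>

lemma solution_eq_right:
  assumes "ode_solution G X {0<..} \<Phi>" "z \<ge> 0"
  shows "\<Phi> z = Y z *v \<Phi> 0"
proof -
  have "ode_solution G X {0<..<z} (\<lambda>z. \<Phi> z - Y z *v \<Phi> 0)"
    by (intro ode_solution_diff ode_solution_Y ode_solution_subset[OF assms(1)]) auto
  from solution_growth_bound[OF this assms(2)] show ?thesis
    by (simp add: Y_0)
qed

lemma solution_eq:
  assumes "ode_solution G X UNIV \<Phi>"
  shows "\<Phi> z = Y z *v \<Phi> 0"
proof (cases "z \<ge> 0")
  case True
  with assms show ?thesis
    by (intro solution_eq_right) (auto intro: ode_solution_subset)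
next
  case False
  have "ode_solution G X {z<..<0} (\<lambda>z. \<Phi> z - Y z *v \<Phi> 0)"
    by (intro ode_solution_diff ode_solution_Y ode_solution_subset[OF assms(1)]) auto
  from solution_growth_bound_backward[OF this] False show ?thesis
    by (simp add: Y_0)
qed

text \<open>By periodicity the left side is again a solution in \<open>z\<close>, with value
  \<open>Y 1 *v v\<close> at 0; uniqueness gives this Floquet relation.\<close>

lemma Y_shift: "Y (z + 1) *v v = Y z *v (Y 1 *v v)"
proof -
  have Y: "ode_solution G X UNIV (\<lambda>z. Y z *v v)"
    by (rule ode_solution_Y)
  have "ode_solution G X UNIV (\<lambda>z. Y (z + 1) *v v)"
    unfolding ode_solution_def
  proof (intro conjI ballI impI)
    show "continuous_on (closure UNIV) (\<lambda>z. Y (z + 1) *v v)"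
      using Y unfolding ode_solution_def
      by (intro continuous_on_compose2[of UNIV "\<lambda>z. Y z *v v" _ "\<lambda>z. z + 1"] continuous_on_add
          continuous_on_id continuous_on_const) auto
    fix z assume "z \<notin> X"
    then have "((\<lambda>z. Y z *v v) has_vector_derivative G (z + 1) *v (Y (z + 1) *v v)) (at (z + 1))"
      using Y X_periodic unfolding ode_solution_def by blast
    then show "((\<lambda>z. Y (z + 1) *v v) has_vector_derivative G z *v (Y (z + 1) *v v)) (at z)"
      unfolding G_periodic by (rule has_vector_derivative_shift)
  qed
  from solution_eq[OF this, of z] show ?thesis by simp
qed

text \<open>The growth bounds hold in both directions, so a solution vanishing at one point vanishes
  at 0. This serves as invertibility of the transfer matrices.\<close>

lemma Y_mult_eq_0D:
  assumes "Y z *v v = 0"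
  shows "v = 0"
proof (cases "z \<ge> 0")
  case True
  from solution_growth_bound_backward[OF ode_solution_Y True, of v] assms show ?thesis
    by (simp add: Y_0)
next
  case False
  then have "z \<le> 0" by simp
  from solution_growth_bound[OF ode_solution_Y this, of v] assms show ?thesis
    by (simp add: Y_0)
qed

text \<open>Within one period a solution grows by at most the factor \<open>exp K\<close>, so
  geometric decay along the integers gives exponential decay with rate
  \<open>- ln \<rho>\<close>.\<close>

lemma exponential_decay_of_iterates:
  assumes sol: "ode_solution G X {0<..} \<Phi>"
    and iter: "\<And>m::nat. norm (\<Phi> m) \<le> C * \<rho> ^ m" and \<rho>: "0 < \<rho>" "\<rho> < 1"
  shows "\<exists>C>0. \<exists>c>0. \<forall>z\<in>{0<..}. norm (\<Phi> z) \<le> C * exp (- c * \<bar>z\<bar>)"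
proof -
  \<comment> \<open>The maximum with 1 makes the constant positive even if \<open>C\<close> is
    not.\<close>
  define B where "B = max C 1"
  have B: "B > 0" "C \<le> B" by (auto simp: B_def)
  have "norm (\<Phi> z) \<le> (exp K * B / \<rho>) * exp (- (- ln \<rho>) * \<bar>z\<bar>)" if "z > 0" for z
  proof -
    define m where "m = nat \<lfloor>z\<rfloor>"
    have m: "real m \<le> z" "z \<le> real m + 1"
      using that unfolding m_def by linarith+
    have "norm (\<Phi> z) \<le> exp (K * (z - m)) * norm (\<Phi> m)"
      using m by (intro solution_growth_bound ode_solution_subset[OF sol]) auto
    also have "\<dots> \<le> exp K * (B * \<rho> ^ m)"
    proof (rule mult_mono)
      show "exp (K * (z - m)) \<le> exp K"
        using m K_nonneg by (simp add: mult_left_le)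
      show "norm (\<Phi> m) \<le> B * \<rho> ^ m"
        using \<rho> by (intro order_trans[OF iter[of m] mult_right_mono[OF B(2)]]) simp
    qed auto
    also have "\<rho> ^ m \<le> exp (z * ln \<rho>) / \<rho>"
    proof -
      \<comment> \<open>Since \<open>ln \<rho>\<close> is negative, the inequality
        \<open>z - 1 \<le> m\<close> is reversed; this shift by one costs the factor
        \<open>1 / \<rho>\<close>.\<close>
      have "real m * ln \<rho> \<le> (z - 1) * ln \<rho>"
        using m \<rho> by (intro mult_right_mono_neg) auto
      then have "exp (real m * ln \<rho>) \<le> exp (z * ln \<rho> - ln \<rho>)"
        by (simp add: algebra_simps)
      then show ?thesis
        using \<rho> by (simp add: exp_diff exp_of_nat_mult)
    qed
    finally show ?thesis
      using that B \<rho> by (simp add: mult_left_mono mult_ac)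
  qed
  moreover have "exp K * B / \<rho> > 0" "- ln \<rho> > 0"
    using B \<rho> by auto
  ultimately show ?thesis
    by (metis greaterThan_iff)
qed

text \<open>The value at \<open>m\<close> is controlled backward by every value on the following
  unit interval. Integrating the squares over that interval bounds it by the integral over the
  half-line, uniformly in \<open>m\<close>.\<close>

lemma square_integrable_imp_bounded_iterates:
  assumes sol: "ode_solution G X {0<..} \<Phi>"
    and int: "set_integrable lborel {0<..} (\<lambda>z. (norm (\<Phi> z))\<^sup>2)"
  obtains B where "\<And>m::nat. norm (\<Phi> m) \<le> B"
proof
  fix m :: nat
  let ?I = "LINT z:{0<..}|lborel. (norm (\<Phi> z))\<^sup>2"
  have *: "(norm (\<Phi> m))\<^sup>2 \<le> (exp K)\<^sup>2 * (norm (\<Phi> z))\<^sup>2" if z: "z \<in> {m<..<real m + 1}" for z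
  proof -
    have "norm (\<Phi> m) \<le> exp (K * (z - m)) * norm (\<Phi> z)"
      using z by (intro solution_growth_bound_backward ode_solution_subset[OF sol]) auto
    also have "\<dots> \<le> exp K * norm (\<Phi> z)"
      using z K_nonneg by (intro mult_right_mono) (auto simp: mult_left_le)
    finally show ?thesis
      by (metis norm_ge_zero power_mono power_mult_distrib)
  qed
  have "(norm (\<Phi> m))\<^sup>2 = (LINT z|lborel. indicator {m<..<real m + 1} z *\<^sub>R (norm (\<Phi> m))\<^sup>2)"
    by (simp add: measure_def)
  also have "\<dots> \<le> (LINT z|lborel. (exp K)\<^sup>2 * (indicator {0<..} z *\<^sub>R (norm (\<Phi> z))\<^sup>2))"
  proof (rule integral_mono)
    show "integrable lborel (\<lambda>z. indicator {m<..<real m + 1} z *\<^sub>R (norm (\<Phi> m))\<^sup>2)"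
      by (intro integrable_scaleR_left integrable_real_indicator) auto
    show "integrable lborel (\<lambda>z. (exp K)\<^sup>2 * (indicator {0<..} z *\<^sub>R (norm (\<Phi> z))\<^sup>2))"
      using int unfolding set_integrable_def by (rule integrable_mult_right)
  qed (auto simp: indicator_def intro!: *)
  also have "\<dots> = (exp K)\<^sup>2 * ?I"
    by (simp add: set_lebesgue_integral_def)
  finally show "norm (\<Phi> m) \<le> sqrt ((exp K)\<^sup>2 * ?I)"
    by (rule real_le_rsqrt)
qed

section \<open>Floquet modes along the integers\<close>

lemma Y_nat_modes:
  fixes P :: "complex^'n^'n"
  assumes "\<And>x. Y 1 *v (P *v x) = P *v (\<chi> j. l j * x $ j)"
  shows "Y (real m) *v (P *v x) = P *v (\<chi> j. l j ^ m * x $ j)"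
proof (induction m arbitrary: x)
  case 0
  show ?case by (simp add: Y_0)
next
  case (Suc m)
  have "Y (real (Suc m)) *v (P *v x) = Y (real m) *v (Y 1 *v (P *v x))"
    by (simp add: Y_shift flip: add.commute[of "real m"])
  then show ?case
    by (simp add: assms Suc.IH mult_ac)
qed

text \<open>Along the integers each coefficient is multiplied by a power of its eigenvalue, and only
  eigenvalues inside the unit disc contribute. A common bound below 1 for their moduli gives
  geometric decay.\<close>

lemma decaying_modes:
  fixes P :: "complex^'n^'n" and x :: "complex^'n"
  assumes modes: "\<And>x. Y 1 *v (P *v x) = P *v (\<chi> j. l j * x $ j)"
    and x: "\<And>j. cmod (l j) \<ge> 1 \<Longrightarrow> x $ j = 0"
  shows "\<exists>C>0. \<exists>c>0. \<forall>z\<in>{0<..}. norm (Y z *v (P *v x)) \<le> C * exp (- c * \<bar>z\<bar>)"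
proof -
  \<comment> \<open>The added 1/2 keeps the maximum defined and positive when there is no nonzero
    eigenvalue inside the unit disc.\<close>
  define R where "R = insert (1/2) (cmod ` l ` {j. cmod (l j) < 1})"
  define \<rho> where "\<rho> = Max R"
  have R: "finite R" "R \<noteq> {}" by (auto simp: R_def)
  then have \<rho>: "0 < \<rho>" "\<rho> < 1"
    using Max_ge[of R "1/2"] by (auto simp: \<rho>_def) (auto simp: R_def)
  have \<rho>_ge: "cmod (l j) \<le> \<rho>" if "cmod (l j) < 1" for j
    using R that unfolding \<rho>_def by (intro Max_ge) (auto simp: R_def)
  define L where "L = (\<Sum>i\<in>UNIV. \<Sum>j\<in>UNIV. norm (P $ i $ j))"
  have "L \<ge> 0" by (simp add: L_def sum_nonneg)
  show ?thesis
  proof (rule exponential_decay_of_iterates[OF ode_solution_Y _ \<rho>])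
    fix m :: nat
    have "norm (Y (real m) *v (P *v x)) \<le> L * norm (\<chi> j. l j ^ m * x $ j)"
      unfolding Y_nat_modes[OF modes] L_def by (rule norm_matrix_vector_mult_le)
    also have "\<dots> \<le> L * (\<Sum>j\<in>UNIV. cmod (x $ j) * \<rho> ^ m)"
    proof (rule mult_left_mono[OF _ \<open>L \<ge> 0\<close>])
      have "norm (\<chi> j. l j ^ m * x $ j) \<le> (\<Sum>j\<in>UNIV. norm (l j ^ m * x $ j))"
        unfolding norm_vec_def by (rule order_trans[OF L2_set_le_sum]) auto
      also have "\<dots> \<le> (\<Sum>j\<in>UNIV. cmod (x $ j) * \<rho> ^ m)"
      proof (rule sum_mono)
        fix j
        show "norm (l j ^ m * x $ j) \<le> cmod (x $ j) * \<rho> ^ m"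
        proof (cases "cmod (l j) < 1")
          case True
          then have "cmod (l j) ^ m \<le> \<rho> ^ m"
            by (intro power_mono \<rho>_ge) auto
          then show ?thesis
            by (simp add: norm_mult norm_power mult_left_mono mult.commute[of "cmod (l j) ^ m"])
        qed (simp add: x)
      qed
      finally show "norm (\<chi> j. l j ^ m * x $ j) \<le> (\<Sum>j\<in>UNIV. cmod (x $ j) * \<rho> ^ m)" .
    qed
    also have "\<dots> = L * (\<Sum>j\<in>UNIV. cmod (x $ j)) * \<rho> ^ m"
      by (simp add: sum_distrib_right)
    finally show "norm (Y (real m) *v (P *v x)) \<le> L * (\<Sum>j\<in>UNIV. cmod (x $ j)) * \<rho> ^ m" .
  qed
qed

text \<open>A left inverse of \<open>P\<close> recovers \<open>l j ^ m * x $ j\<close> from the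
  value of the solution at \<open>m\<close>. Those values are bounded, whereas the powers of
  \<open>l j\<close> are not.\<close>

lemma square_integrable_imp_no_growing_mode:
  fixes P :: "complex^'n^'n" and x :: "complex^'n"
  assumes modes: "\<And>x. Y 1 *v (P *v x) = P *v (\<chi> j. l j * x $ j)"
    and "invertible P" and sol: "ode_solution G X {0<..} \<Phi>"
    and int: "set_integrable lborel {0<..} (\<lambda>z. (norm (\<Phi> z))\<^sup>2)"
    and x: "\<Phi> 0 = P *v x" and j: "cmod (l j) > 1"
  shows "x $ j = 0"
proof (rule ccontr)
  assume "x $ j \<noteq> 0"
  from \<open>invertible P\<close> obtain P' where P': "P' ** P = mat 1"
    by (auto simp: invertible_def)
  define L where "L = (\<Sum>i\<in>UNIV. \<Sum>j\<in>UNIV. norm (P' $ i $ j))"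
  have "L \<ge> 0" by (simp add: L_def sum_nonneg)
  from square_integrable_imp_bounded_iterates[OF sol int]
  obtain B where B: "\<And>m::nat. norm (\<Phi> m) \<le> B" by blast
  have "cmod (l j) ^ m \<le> L * B / cmod (x $ j)" for m
  proof -
    have "\<Phi> m = P *v (\<chi> j. l j ^ m * x $ j)"
      using solution_eq_right[OF sol, of m] by (simp add: x Y_nat_modes[OF modes])
    then have "P' *v \<Phi> m = (\<chi> j. l j ^ m * x $ j)"
      by (simp add: matrix_vector_mul_assoc P')
    then have "l j ^ m * x $ j = (P' *v \<Phi> m) $ j" by simp
    also have "cmod \<dots> \<le> norm (P' *v \<Phi> m)"
      by (rule Finite_Cartesian_Product.norm_nth_le)
    also have "\<dots> \<le> L * norm (\<Phi> m)"
      unfolding L_def by (rule norm_matrix_vector_mult_le)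
    also have "\<dots> \<le> L * B"
      by (intro mult_left_mono B \<open>L \<ge> 0\<close>)
    finally show ?thesis
      using \<open>x $ j \<noteq> 0\<close> by (simp add: norm_mult norm_power field_simps)
  qed
  with real_arch_pow[OF j, of "L * B / cmod (x $ j)"] show False
    by (auto simp: not_le[symmetric])
qed

end

section \<open>Eigenfunctions on a half-line\<close>

text \<open>The two rows of \<open>N\<close> encode the radiation condition at 0 as a kernel, so
  that one notion covers both half-lines after reflection.\<close>

definition half_line_eigenfunction ::
    "(real \<Rightarrow> mat4) \<Rightarrow> real set \<Rightarrow> complex^idx^2 \<Rightarrow> (real \<Rightarrow> field4) \<Rightarrow> bool" where
  "half_line_eigenfunction G X N \<Phi> \<longleftrightarrow>
     ode_solution G X {0<..} \<Phi> \<and>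
     (\<exists>z\<in>{0<..}. \<Phi> z \<noteq> 0) \<and>
     set_integrable lborel {0<..} (\<lambda>z. (norm (\<Phi> z))\<^sup>2) \<and>
     N *v \<Phi> 0 = 0"

text \<open>Supplies the mode coefficients of the eigenfunction: \<open>j\<close> will be the only
  growing mode and \<open>N\<close> the radiation condition.\<close>

lemma ex_boundary_mode:
  fixes N :: "complex^idx^2" and P :: mat4
  obtains x :: field4 where "x \<noteq> 0" "x $ j = 0" "N *v (P *v x) = 0"
proof -
  \<comment> \<open>Three equations in four unknowns, padded by a zero row to a singular square matrix.\<close>
  define B :: mat4 where
    "B = (\<chi> i. case i of Inl a \<Rightarrow> (N ** P) $ a | Inr a \<Rightarrow> if a = 1 then axis j 1 else 0)"
  have "det B = 0"
    by (rule det_zero_row(1)[of "Inr 2"]) (simp add: B_def row_def vec_eq_iff)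
  then obtain x where x: "x \<noteq> 0" "B *v x = 0"
    by (rule det_0_imp_ex_kernel)
  have "((N ** P) *v x) $ a = (B *v x) $ Inl a" for a
    by (simp add: B_def matrix_vector_mult_def)
  then have "N *v (P *v x) = 0"
    by (simp add: x vec_eq_iff matrix_vector_mul_assoc)
  moreover have "x $ j = (B *v x) $ Inr 1"
    by (simp add: B_def matrix_vector_mult_def axis_def if_distrib[of "\<lambda>c. c * _"] cong: if_cong)
  ultimately show thesis
    using that x by simp
qed

text \<open>For existence, a boundary mode without growing component starts a decaying, hence square
  integrable, solution. For an arbitrary eigenfunction, square integrability removes the growing
  coefficient and leaves only decaying modes.\<close>

lemma half_line_eigenfunctions:
  fixes P :: mat4
  assumes sys: "periodic_system G X K Y" and "invertible P"
    and modes: "\<And>x. Y 1 *v (P *v x) = P *v (\<chi> j. l j * x $ j)"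
    and growing: "{j. cmod (l j) > 1} = {j0}" and no_unit: "\<And>j. cmod (l j) \<noteq> 1"
  shows "\<exists>\<Phi>. half_line_eigenfunction G X N \<Phi>"
    and "half_line_eigenfunction G X N \<Phi> \<Longrightarrow> decays_exponentially_on {0<..} \<Phi>"
proof -
  interpret periodic_system G X K Y by (rule sys)
  obtain x where x: "x \<noteq> 0" "x $ j0 = 0" "N *v (P *v x) = 0"
    by (rule ex_boundary_mode)
  let ?\<Phi> = "\<lambda>z. Y z *v (P *v x)"
  have "P *v x \<noteq> 0"
    using \<open>invertible P\<close> x(1) by (metis invertible_left_inverse matrix_left_invertible_ker)
  \<comment> \<open>The eigenfunction must be nonzero inside the open half-line, not only at 0; the
    point 1 serves as witness.\<close>
  then have "?\<Phi> 1 \<noteq> 0"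
    using Y_mult_eq_0D by blast
  moreover have "x $ j = 0" if "cmod (l j) \<ge> 1" for j
  proof -
    have "j \<in> {j. cmod (l j) > 1}"
      using that no_unit[of j] by simp
    with x(2) show ?thesis
      unfolding growing by simp
  qed
  then have "\<exists>C>0. \<exists>c>0. \<forall>z\<in>{0<..}. norm (?\<Phi> z) \<le> C * exp (- c * \<bar>z\<bar>)"
    by (rule decaying_modes[OF modes])
  then have "set_integrable lborel {0<..} (\<lambda>z. (norm (?\<Phi> z))\<^sup>2)"
    using ode_solution_Y[of "{0<..}" "P *v x"]
    by (intro exponential_decay_imp_square_integrable) (auto simp: ode_solution_def)
  ultimately have "half_line_eigenfunction G X N ?\<Phi>"
    unfolding half_line_eigenfunction_def
    using x(3) by (auto simp: Y_0 intro!: ode_solution_Y bexI[of _ 1])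
  then show "\<exists>\<Phi>. half_line_eigenfunction G X N \<Phi>"
    by blast
  assume \<Phi>: "half_line_eigenfunction G X N \<Phi>"
  obtain P' where "P ** P' = mat 1"
    using \<open>invertible P\<close> by (auto simp: invertible_def)
  then have \<Phi>0: "\<Phi> 0 = P *v (P' *v \<Phi> 0)"
    by (simp add: matrix_vector_mul_assoc)
  have sol: "ode_solution G X {0<..} \<Phi>"
    using \<Phi> by (simp add: half_line_eigenfunction_def)
  \<comment> \<open>With no modulus equal to 1, the condition \<open>cmod (l j) \<ge> 1\<close>
    singles out growing modes.\<close>
  have "(P' *v \<Phi> 0) $ j = 0" if "cmod (l j) \<ge> 1" for j
    using \<Phi> that no_unit[of j] \<open>invertible P\<close> modes \<Phi>0
    by (intro square_integrable_imp_no_growing_mode[of P l \<Phi>])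
       (auto simp: half_line_eigenfunction_def)
  from decaying_modes[OF modes this]
  show "decays_exponentially_on {0<..} \<Phi>"
    unfolding decays_exponentially_on_def \<Phi>0[symmetric]
    using solution_eq_right[OF sol] by (metis greaterThan_iff less_imp_le)
qed

text \<open>The same eigenvectors serve, with inverted eigenvalues, because \<open>Y (- 1)\<close>
  inverts \<open>Y 1\<close>. No eigenvalue vanishes since \<open>Y 1\<close> is injective.\<close>

lemma reflected_modes:
  fixes P :: mat4
  assumes sys: "periodic_system G X K Y" and "invertible P"
    and modes: "\<And>x. Y 1 *v (P *v x) = P *v (\<chi> j. l j * x $ j)"
  shows "l j \<noteq> 0" and "Y (- 1) *v (P *v x) = P *v (\<chi> j. inverse (l j) * x $ j)"
proof -
  interpret periodic_system G X K Y by (rule sys)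
  show nz: "l j \<noteq> 0" for j
  proof
    assume "l j = 0"
    then have "(\<chi> i. l i * axis j 1 $ i) = 0"
      by (simp add: vec_eq_iff axis_def)
    then have "Y 1 *v (P *v axis j 1) = 0"
      using modes[of "axis j 1"] by simp
    then have "P *v axis j 1 = 0"
      by (rule Y_mult_eq_0D)
    then have "axis j (1::complex) = 0"
      using \<open>invertible P\<close> by (metis invertible_left_inverse matrix_left_invertible_ker)
    then show False by (simp add: axis_eq_0_iff)
  qed
  have "Y 1 *v (P *v (\<chi> j. inverse (l j) * x $ j)) = P *v x"
    by (simp add: modes nz mult.assoc[symmetric])
  \<comment> \<open>At \<open>- 1\<close> the Floquet relation says
    \<open>Y (- 1) *v (Y 1 *v v) = v\<close>.\<close>
  with Y_shift[of "- 1" "P *v (\<chi> j. inverse (l j) * x $ j)"]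
  show "Y (- 1) *v (P *v x) = P *v (\<chi> j. inverse (l j) * x $ j)"
    by (simp add: Y_0)
qed

section \<open>Photonic crystals\<close>

definition discontinuities ::
    "(real \<Rightarrow> complex^2^2) \<Rightarrow> (real \<Rightarrow> complex^2^2) \<Rightarrow> real set" where
  "discontinuities eps mu = {z. \<not> (isCont eps z \<and> isCont mu z)}"

lemma maxwell_solution_iff_ode_solution:
  "maxwell_solution eps mu \<omega> I \<Phi> \<longleftrightarrow>
     ode_solution (generator eps mu \<omega>) (discontinuities eps mu) I \<Phi>"
  unfolding maxwell_solution_def ode_solution_def discontinuities_def by simp

lemma isCont_periodic:
  fixes f :: "real \<Rightarrow> 'a::topological_space"
  assumes "\<forall>z. f (z + 1) = f z"
  shows "isCont f (z + 1) \<longleftrightarrow> isCont f z"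
proof
  assume "isCont f (z + 1)"
  then have "isCont (\<lambda>x. f (x + 1)) z"
    by (intro isCont_o2[of z "\<lambda>x. x + 1" f] continuous_intros) auto
  then show "isCont f z" using assms by simp
next
  assume "isCont f z"
  then have "isCont (\<lambda>x. f (x - 1)) (z + 1)"
    by (intro isCont_o2[of "z + 1" "\<lambda>x. x - 1" f] continuous_intros) auto
  moreover have "f (x - 1) = f x" for x
    using spec[OF assms, of "x - 1"] by simp
  ultimately show "isCont f (z + 1)" by simp
qed

text \<open>Entries of \<open>A_mat\<close> are zero or entries of \<open>eps\<close> and
  \<open>mu\<close> up to a factor of modulus one, and \<open>matrix_inv Q4\<close> contributes
  constants. The bound is uniform in \<open>z\<close> but depends on
  \<open>\<omega>\<close>.\<close>

lemma generator_bound: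
  assumes "bounded (range eps)" "bounded (range mu)"
  obtains K where "\<And>z v. norm (generator eps mu \<omega> z *v v) \<le> K * norm v"
proof -
  from assms obtain Be Bm where B: "\<And>z. norm (eps z) \<le> Be" "\<And>z. norm (mu z) \<le> Bm"
    by (auto simp: bounded_iff)
  have B0: "Be \<ge> 0" "Bm \<ge> 0"
    using order_trans[OF norm_ge_zero B(1)] order_trans[OF norm_ge_zero B(2)] by auto
  have entry: "norm (M $ a $ b) \<le> norm M" for M :: "complex^2^2" and a b
    by (meson Finite_Cartesian_Product.norm_nth_le order_trans)
  have A: "norm (A_mat eps mu z $ i $ j) \<le> Be + Bm" for z i j
    using entry[of "eps z"] entry[of "mu z"] B[of z] B0
    by (auto simp: A_mat_def cscale_def block_mat_def norm_mult split: sum.split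
        intro: add_increasing[OF _ order_trans[of _ "norm (mu z)"]]
          add_increasing2[OF _ order_trans[of _ "norm (eps z)"]])
  define K where "K i = norm \<omega> * (\<Sum>k\<in>UNIV. norm (matrix_inv Q4 $ i $ k) * (Be + Bm))" for i
  have G: "norm (generator eps mu \<omega> z $ i $ j) \<le> K i" for z i j
  proof -
    have "norm (\<Sum>k\<in>UNIV. matrix_inv Q4 $ i $ k * A_mat eps mu z $ k $ j)
        \<le> (\<Sum>k\<in>UNIV. norm (matrix_inv Q4 $ i $ k) * (Be + Bm))"
      by (intro sum_norm_le) (simp add: norm_mult mult_left_mono A)
    then show ?thesis
      by (simp add: generator_def cscale_def matrix_matrix_mult_def norm_mult K_def mult_left_mono)
  qed
  have "norm (generator eps mu \<omega> z *v v) \<le> (\<Sum>i\<in>UNIV. \<Sum>j\<in>(UNIV::idx set). K i) * norm v" for z v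
    by (rule order_trans[OF norm_matrix_vector_mult_le]) (intro mult_right_mono sum_mono G norm_ge_zero)
  then show thesis by (rule that)
qed

lemma periodic_system_photonic_crystal:
  assumes crystal: "photonic_crystal eps mu" and transfer: "transfer_matrix eps mu T"
  obtains K where
    "periodic_system (generator eps mu \<omega>) (discontinuities eps mu) K (\<lambda>z. T \<omega> z 0)"
proof -
  obtain K where K: "\<And>z v. norm (generator eps mu \<omega> z *v v) \<le> K * norm v"
    using crystal unfolding photonic_crystal_def by (metis generator_bound)
  have "periodic_system (generator eps mu \<omega>) (discontinuities eps mu) K (\<lambda>z. T \<omega> z 0)"
  proof
    fix a b :: real
    have "discontinuities eps mu \<inter> {a..b}
        = {z\<in>{a..b}. \<not> isCont eps z} \<union> {z\<in>{a..b}. \<not> isCont mu z}"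
      by (auto simp: discontinuities_def)
    then show "finite (discontinuities eps mu \<inter> {a..b})"
      using crystal by (simp add: photonic_crystal_def piecewise_continuous_def)
  next
    fix z
    show "generator eps mu \<omega> (z + 1) = generator eps mu \<omega> z"
      using crystal by (simp add: photonic_crystal_def generator_def A_mat_def)
    show "z + 1 \<in> discontinuities eps mu \<longleftrightarrow> z \<in> discontinuities eps mu"
      using crystal by (simp add: photonic_crystal_def discontinuities_def isCont_periodic)
  qed (use K transfer in \<open>auto simp: transfer_matrix_def discontinuities_def\<close>)
  then show thesis by (rule that)
qed

text \<open>The solution started at an eigenvector for \<open>x\<close> is multiplied by
  \<open>x\<close> over each period. Modulus one gives \<open>x = exp (\<i> * Arg x)\<close>, hence
  \<open>k = Arg x\<close>.\<close>

lemma unit_eigenvalue_imp_eigenfrequency: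
  assumes sys: "periodic_system (generator eps mu \<omega>) (discontinuities eps mu) K (\<lambda>z. T \<omega> z 0)"
    and "det (mat x - monodromy T \<omega>) = 0" "cmod x = 1"
  obtains k where "k \<in> {-pi..pi}" "eigenfrequency eps mu k \<omega>"
proof
  interpret periodic_system "generator eps mu \<omega>" "discontinuities eps mu" K "\<lambda>z. T \<omega> z 0"
    by (rule sys)
  obtain v where v: "v \<noteq> 0" "T \<omega> 1 0 *v v = x *s v"
    using det_0_imp_ex_kernel[OF assms(2)]
    by (metis mat_mult_vec matrix_vector_mult_diff_rdistrib eq_iff_diff_eq_0 monodromy_def)
  show "Arg x \<in> {-pi..pi}"
    using Arg_bounded[of x] by auto
  have "x = exp (\<i> * Arg x)"
    using Arg_eq[of x] assms(3) by (cases "x = 0") auto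
  then show "eigenfrequency eps mu (Arg x) \<omega>"
    unfolding eigenfrequency_def maxwell_solution_iff_ode_solution
    using Y_0 v by (intro exI[of _ "\<lambda>z. T \<omega> z 0 *v v"] conjI allI ode_solution_Y exI[of _ 0])
      (auto simp: Y_shift vector_scalar_commute)
qed

text \<open>This is the block row \<open>(s Q, I)\<close>, whose kernel is
  \<open>H = - s Q E\<close>. Thus \<open>s = 1\<close> is the radiation condition for the right
  half-line and \<open>s = - 1\<close> the one for the left.\<close>

definition outgoing :: "complex \<Rightarrow> complex^idx^2" where
  "outgoing s = (\<chi> a i. case i of Inl b \<Rightarrow> s * Q2 $ a $ b | Inr b \<Rightarrow> if a = b then 1 else 0)"

lemma outgoing_mult: "outgoing s *v v = H_part v + s *s (Q2 *v E_part v)"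
proof -
  have "(\<Sum>i\<in>UNIV. f i) = f (Inl 1) + f (Inl 2) + f (Inr 1) + f (Inr 2)" for f :: "idx \<Rightarrow> complex"
  proof -
    have "(UNIV :: idx set) = {Inl 1, Inl 2, Inr 1, Inr 2}"
      by (auto simp: UNIV_sum UNIV_2)
    then have "sum f UNIV = sum f {Inl 1, Inl 2, Inr 1, Inr 2}"
      by (rule arg_cong)
    then show ?thesis by (simp add: add.assoc)
  qed
  then show ?thesis
    by (simp add: outgoing_def H_part_def E_part_def matrix_vector_mult_def vec_eq_iff forall_2
        sum_2 distrib_left)
qed

lemma eigenfunction_plus_iff:
  "eigenfunction_plus eps mu \<omega> \<Phi> \<longleftrightarrow>
     half_line_eigenfunction (generator eps mu \<omega>) (discontinuities eps mu) (outgoing 1) \<Phi>"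
  unfolding eigenfunction_plus_def half_line_eigenfunction_def maxwell_solution_iff_ode_solution
  by (simp add: outgoing_mult eq_neg_iff_add_eq_0)

text \<open>Reflection fixes 0, so the boundary condition keeps its form while the equation changes
  sign; square integrability is carried over by the substitution
  \<open>z \<mapsto> - z\<close>.\<close>

lemma eigenfunction_minus_iff:
  "eigenfunction_minus eps mu \<omega> \<Phi> \<longleftrightarrow>
     half_line_eigenfunction (\<lambda>z. - generator eps mu \<omega> (- z)) {z. - z \<in> discontinuities eps mu}
       (outgoing (- 1)) (\<lambda>z. \<Phi> (- z))"
proof -
  let ?G = "generator eps mu \<omega>" and ?X = "discontinuities eps mu"
  \<comment> \<open>Reflecting twice restores the system, so the reflection lemma yields both
    implications.\<close>
  have "ode_solution ?G ?X {..<0} \<Phi> \<longleftrightarrow>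
      ode_solution (\<lambda>z. - ?G (- z)) {z. - z \<in> ?X} {0<..} (\<lambda>z. \<Phi> (- z))"
    using ode_solution_reflect[of ?G ?X "{..<0}" \<Phi>]
      ode_solution_reflect[of "\<lambda>z. - ?G (- z)" "{z. - z \<in> ?X}" "{0<..}" "\<lambda>z. \<Phi> (- z)"]
    by auto
  moreover have "set_integrable lborel {..<0} (\<lambda>z. (norm (\<Phi> z))\<^sup>2) \<longleftrightarrow>
      set_integrable lborel {0<..} (\<lambda>z. (norm (\<Phi> (- z)))\<^sup>2)"
    using lborel_integrable_real_affine_iff[of "- 1" "\<lambda>z. indicator {..<0} z *\<^sub>R (norm (\<Phi> z))\<^sup>2" 0]
    by (simp add: set_integrable_def indicator_def)
  moreover have "(\<exists>z\<in>{..<0}. \<Phi> z \<noteq> 0) \<longleftrightarrow> (\<exists>z\<in>{0<..}. \<Phi> (- z) \<noteq> 0)"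
    by (metis greaterThan_iff lessThan_iff neg_0_less_iff_less neg_less_0_iff_less minus_minus)
  ultimately show ?thesis
    unfolding eigenfunction_minus_def half_line_eigenfunction_def maxwell_solution_iff_ode_solution
    by (simp add: outgoing_mult)
qed

text \<open>Without eigenvalues of modulus one the two counts add up to 4; half their difference
  being 1 or -1 leaves 3 and 1, or 1 and 3.\<close>

lemma Ind_split:
  assumes "\<And>j. cmod (lam \<omega> j) \<noteq> 1"
  shows "Ind lam \<omega> = 1 \<Longrightarrow> \<exists>j0. {j. cmod (lam \<omega> j) > 1} = {j0}"
    and "Ind lam \<omega> = -1 \<Longrightarrow> \<exists>j0. {j. cmod (lam \<omega> j) < 1} = {j0}"
proof -
  let ?S = "{j. cmod (lam \<omega> j) < 1}" and ?B = "{j. cmod (lam \<omega> j) > 1}"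
  have "?S \<union> ?B = UNIV"
    using assms by (auto simp: neq_iff)
  then have "card ?S + card ?B = 4"
    by (subst card_Un_disjoint[symmetric]) auto
  then have "Ind lam \<omega> = 1 \<Longrightarrow> card ?B = 1" "Ind lam \<omega> = -1 \<Longrightarrow> card ?S = 1"
    unfolding Ind_def by simp_all
  then show "Ind lam \<omega> = 1 \<Longrightarrow> \<exists>j0. ?B = {j0}" "Ind lam \<omega> = -1 \<Longrightarrow> \<exists>j0. ?S = {j0}"
    by (meson card_1_singletonE)+
qed

text \<open>Away from branch points the eigenvalues are distinct, so an eigenbasis exists. The
  bijection \<open>f\<close> reconciles the index type \<open>4\<close> of the listing with the type
  \<open>2 + 2\<close> of the field components.\<close>

lemma monodromy_eigenbasis:
  assumes eigenvalues: "eigenvalue_listing (monodromy T) lam"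
    and "\<not> branch_point lam \<omega>"
  obtains f :: "idx \<Rightarrow> 4" and P where "bij f" "invertible P"
    "\<And>x. T \<omega> 1 0 *v (P *v x) = P *v (\<chi> j. lam \<omega> (f j) * x $ j)"
proof -
  have "card (UNIV :: idx set) = card (UNIV :: 4 set)"
    by simp
  then obtain f :: "idx \<Rightarrow> 4" where f: "bij f"
    using finite_same_card_bij[of "UNIV :: idx set" "UNIV :: 4 set"] by auto
  have "inj (\<lambda>j. lam \<omega> (f j))"
    using assms(2) bij_is_inj[OF f] unfolding branch_point_def
    by (simp add: inj_def)
  moreover have "det (mat (lam \<omega> (f j)) - T \<omega> 1 0) = 0" for j
    using eigenvalues by (auto simp: eigenvalue_listing_def monodromy_def intro: prod_zero)
  ultimately obtain P where "invertible P"
    "\<And>x. T \<omega> 1 0 *v (P *v x) = P *v (\<chi> j. lam \<omega> (f j) * x $ j)"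
    using ex_eigenbasis by blast
  with f show thesis by (rule that)
qed

lemma singleton_vimage_bij:
  assumes "bij f" "{j. Q j} = {j0}"
  shows "{i. Q (f i)} = {inv f j0}"
  using assms by (auto simp: set_eq_iff bij_inv_eq_iff)

theorem theorem15:
  fixes eps mu :: "real \<Rightarrow> complex^2^2"
    and T :: "complex \<Rightarrow> real \<Rightarrow> real \<Rightarrow> mat4"
    and lam :: "complex \<Rightarrow> 4 \<Rightarrow> complex"
    and J :: "nat set"
    and om :: "nat \<Rightarrow> real \<Rightarrow> complex"
    and n :: nat
    and D gi :: "complex set"
    and wB :: complex
  assumes crystal: "photonic_crystal eps mu"
    and transfer: "transfer_matrix eps mu T"
    and eigenvalues: "eigenvalue_listing (monodromy T) lam"
    and bands: "spectral_bands eps mu (monodromy T) J om"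
    and partition: "partition_assumption J om"
    and n: "n \<in> J"
    and closed: "closed_band om n"
    and isolated: "\<And>m. m \<in> J \<Longrightarrow> m \<noteq> n \<Longrightarrow> band_curve om n \<inter> band_curve om m = {}"
    and analytic: "extends_analytically om n"
    and domain: "D \<in> partitioned_domains (band_curve om n)"
    and boundary: "jordan_domain_bounded_by D gi" "gi \<subseteq> band_curve om n"
    and no_bands: "D \<inter> (\<Union>m\<in>J. band_curve om m) = {}"
    and wB: "wB \<in> D"
  shows "(has_Ind lam D 1 \<and> W om n wB = 1 \<longrightarrow>
           (\<forall>\<omega>\<in>D. \<not> branch_point lam \<omega> \<longrightarrow>
              eigenvalue_plus eps mu \<omega> \<and>
              (\<forall>\<Phi>. eigenfunction_plus eps mu \<omega> \<Phi> \<longrightarrow> decays_exponentially_on {0<..} \<Phi>))) \<and>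
         (has_Ind lam D (-1) \<and> W om n wB = -1 \<longrightarrow>
           (\<forall>\<omega>\<in>D. \<not> branch_point lam \<omega> \<longrightarrow>
              eigenvalue_minus eps mu \<omega> \<and>
              (\<forall>\<Phi>. eigenfunction_minus eps mu \<omega> \<Phi> \<longrightarrow> decays_exponentially_on {..<0} \<Phi>)))"
proof -
  \<comment> \<open>An eigenvalue of modulus one would make \<open>\<omega>\<close> an
    eigenfrequency and so put it on some band, which \<open>no_bands\<close> excludes.\<close>
  have no_unit: "cmod (lam \<omega> j) \<noteq> 1" if "\<omega> \<in> D" for \<omega> j
  proof
    assume "cmod (lam \<omega> j) = 1"
    moreover have "det (mat (lam \<omega> j) - monodromy T \<omega>) = 0"
      using eigenvalues by (auto simp: eigenvalue_listing_def intro: prod_zero)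
    moreover obtain K where
      "periodic_system (generator eps mu \<omega>) (discontinuities eps mu) K (\<lambda>z. T \<omega> z 0)"
      by (rule periodic_system_photonic_crystal[OF crystal transfer])
    ultimately obtain k where k: "k \<in> {-pi..pi}" "eigenfrequency eps mu k \<omega>"
      using unit_eigenvalue_imp_eigenfrequency by blast
    then have "\<omega> \<in> (\<lambda>m. om m k) ` J"
      using bands unfolding spectral_bands_def by blast
    with k(1) have "\<omega> \<in> (\<Union>m\<in>J. band_curve om m)"
      unfolding band_curve_def by blast
    with that no_bands show False
      by blast
  qed
  have plus: "eigenvalue_plus eps mu \<omega> \<and>
      (\<forall>\<Phi>. eigenfunction_plus eps mu \<omega> \<Phi> \<longrightarrow> decays_exponentially_on {0<..} \<Phi>)"
    if ind: "Ind lam \<omega> = 1" and mem: "\<omega> \<in> D" and simple: "\<not> branch_point lam \<omega>" for \<omega>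
  proof -
    obtain K where sys:
      "periodic_system (generator eps mu \<omega>) (discontinuities eps mu) K (\<lambda>z. T \<omega> z 0)"
      by (rule periodic_system_photonic_crystal[OF crystal transfer])
    obtain f :: "idx \<Rightarrow> 4" and P where f: "bij f" and P: "invertible P"
      "\<And>x. T \<omega> 1 0 *v (P *v x) = P *v (\<chi> j. lam \<omega> (f j) * x $ j)"
      using monodromy_eigenbasis[OF eigenvalues simple] by blast
    obtain j0 where "{j. cmod (lam \<omega> j) > 1} = {j0}"
      using Ind_split(1)[OF no_unit[OF mem] ind] by blast
    then have "{i. cmod (lam \<omega> (f i)) > 1} = {inv f j0}"
      by (rule singleton_vimage_bij[OF f])
    from half_line_eigenfunctions[OF sys P this no_unit[OF mem]] show ?thesis
      unfolding eigenvalue_plus_def eigenfunction_plus_iff by blast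
  qed
  have minus: "eigenvalue_minus eps mu \<omega> \<and>
      (\<forall>\<Phi>. eigenfunction_minus eps mu \<omega> \<Phi> \<longrightarrow> decays_exponentially_on {..<0} \<Phi>)"
    if ind: "Ind lam \<omega> = -1" and mem: "\<omega> \<in> D" and simple: "\<not> branch_point lam \<omega>" for \<omega>
  proof -
    obtain K where sys:
      "periodic_system (generator eps mu \<omega>) (discontinuities eps mu) K (\<lambda>z. T \<omega> z 0)"
      by (rule periodic_system_photonic_crystal[OF crystal transfer])
    obtain f :: "idx \<Rightarrow> 4" and P where f: "bij f" and P: "invertible P"
      "\<And>x. T \<omega> 1 0 *v (P *v x) = P *v (\<chi> j. lam \<omega> (f j) * x $ j)"
      using monodromy_eigenbasis[OF eigenvalues simple] by blast
    obtain j0 where "{j. cmod (lam \<omega> j) < 1} = {j0}"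
      using Ind_split(2)[OF no_unit[OF mem] ind] by blast
    then have "{i. cmod (lam \<omega> (f i)) < 1} = {inv f j0}"
      by (rule singleton_vimage_bij[OF f])
    \<comment> \<open>Reflection inverts the eigenvalues, so the single one inside the unit circle
      becomes the single growing one.\<close>
    moreover have "cmod (inverse (lam \<omega> (f i))) > 1 \<longleftrightarrow> cmod (lam \<omega> (f i)) < 1" for i
      using reflected_modes(1)[OF sys P, of i]
      by (simp add: norm_inverse one_less_inverse_iff)
    ultimately have growing: "{i. cmod (inverse (lam \<omega> (f i))) > 1} = {inv f j0}"
      by simp
    have no_unit': "cmod (inverse (lam \<omega> (f i))) \<noteq> 1" for i
      using no_unit[OF mem, of "f i"] by (simp add: norm_inverse)
    note eigenfunctions = half_line_eigenfunctions[OF periodic_system.reflected[OF sys] P(1)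
        reflected_modes(2)[OF sys P] growing no_unit', of "outgoing (- 1)"]
    have "\<exists>\<Phi>. eigenfunction_minus eps mu \<omega> \<Phi>"
    proof -
      obtain \<Psi> where "half_line_eigenfunction (\<lambda>z. - generator eps mu \<omega> (- z))
          {z. - z \<in> discontinuities eps mu} (outgoing (- 1)) \<Psi>"
        using eigenfunctions(1) by blast
      then show ?thesis
        unfolding eigenfunction_minus_iff by (intro exI[of _ "\<lambda>z. \<Psi> (- z)"]) simp
    qed
    moreover have "decays_exponentially_on {..<0} \<Phi>" if "eigenfunction_minus eps mu \<omega> \<Phi>" for \<Phi>
    proof -
      have "decays_exponentially_on {0<..} (\<lambda>z. \<Phi> (- z))"
        using that unfolding eigenfunction_minus_iff by (rule eigenfunctions(2))
      then obtain C c where "C > 0" "c > 0"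
        and le: "\<And>z. z > 0 \<Longrightarrow> norm (\<Phi> (- z)) \<le> C * exp (- c * \<bar>z\<bar>)"
        unfolding decays_exponentially_on_def by auto
      moreover have "norm (\<Phi> z) \<le> C * exp (- c * \<bar>z\<bar>)" if "z < 0" for z
        using le[of "- z"] that by simp
      ultimately show ?thesis
        unfolding decays_exponentially_on_def by blast
    qed
    ultimately show ?thesis
      unfolding eigenvalue_minus_def by blast
  qed
  show ?thesis
    using plus minus unfolding has_Ind_def by blast
qed

end
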